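(* Let $\mu,k,m,n$ be positive integers. If there exist a $(\mu,k,m)$ Latin trade and a $(\mu,k,n)$ Latin trade, then there exists a $(\mu,k,m+n)$ Latin trade.
   Context: A partial Latin square is a square array, some of whose cells are filled with symbols from a finite set and the others empty, such that each symbol occurs at most once in each row and at most once in each column. For a positive integer $\mu$, a $\mu$-way Latin trade is a tuple $(T_1,\dots,T_\mu)$ of partial Latin squares with exactly the same set of filled cells such that: every filled cell $(i,j)$ contains pairwise different entries in $T_1,\dots,T_\mu$; for each row $i$, the set of symbols in row $i$ is the same in all of $T_1,\dots,T_\mu$; and for each column $j$, the set of symbols in column $j$ is the same in all of $T_1,\dots,T_\mu$. For $\mu\le k\le m$, a $(\mu,k,m)$ Latin trade (also called a $\mu$-way $k$-homogeneous Latin trade) is a $\mu$-way Latin trade $(T_1,\dots,T_\mu)$ consisting of $m\times m$ arrays on a set of $m$ symbols such that in each $T_r$ every row has exactly $k$ filled cells, every column has exactly $k$ filled cells, and every symbol appears exactly $k$ times. *)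

theory Defs
  imports Main
begin

text \<open>An array of order \<open>n\<close> has its rows and columns indexed by \<open>{..<n}\<close>; \<open>None\<close> marks an empty
  cell, and there is nothing outside the \<open>n \<times> n\<close> square.\<close>

type_synonym 'a arr = "nat \<Rightarrow> nat \<Rightarrow> 'a option"

definition filled_cells :: "'a arr \<Rightarrow> (nat \<times> nat) set" where
  "filled_cells A = {(i, j). A i j \<noteq> None}"

definition row_symbols :: "'a arr \<Rightarrow> nat \<Rightarrow> 'a set" where
  "row_symbols A i = {s. \<exists>j. A i j = Some s}"

definition col_symbols :: "'a arr \<Rightarrow> nat \<Rightarrow> 'a set" where
  "col_symbols A j = {s. \<exists>i. A i j = Some s}"

definition partial_latin_square :: "nat \<Rightarrow> 'a set \<Rightarrow> 'a arr \<Rightarrow> bool" where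
  "partial_latin_square n S A \<longleftrightarrow>
     finite S \<and>
     filled_cells A \<subseteq> {..<n} \<times> {..<n} \<and>
     (\<forall>i j s. A i j = Some s \<longrightarrow> s \<in> S) \<and>
     (\<forall>i j j' s. A i j = Some s \<and> A i j' = Some s \<longrightarrow> j = j') \<and>
     (\<forall>i i' j s. A i j = Some s \<and> A i' j = Some s \<longrightarrow> i = i')"

text \<open>The tuple \<open>(T\<^sub>1, \<dots>, T\<^sub>\<mu>)\<close> is given as \<open>T 0, \<dots>, T (\<mu> - 1)\<close>; the values \<open>T r\<close> for
  \<open>r \<ge> \<mu>\<close> are irrelevant.\<close>

definition mu_way_latin_trade :: "nat \<Rightarrow> nat \<Rightarrow> 'a set \<Rightarrow> (nat \<Rightarrow> 'a arr) \<Rightarrow> bool" where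
  "mu_way_latin_trade \<mu> n S T \<longleftrightarrow>
     1 \<le> \<mu> \<and>
     (\<forall>r<\<mu>. partial_latin_square n S (T r)) \<and>
     (\<forall>r<\<mu>. \<forall>r'<\<mu>. filled_cells (T r) = filled_cells (T r')) \<and>
     (\<forall>r<\<mu>. \<forall>r'<\<mu>. r \<noteq> r' \<longrightarrow> (\<forall>(i, j) \<in> filled_cells (T r). T r i j \<noteq> T r' i j)) \<and>
     (\<forall>r<\<mu>. \<forall>r'<\<mu>. \<forall>i<n. row_symbols (T r) i = row_symbols (T r') i) \<and>
     (\<forall>r<\<mu>. \<forall>r'<\<mu>. \<forall>j<n. col_symbols (T r) j = col_symbols (T r') j)"

definition homogeneous_latin_trade ::
    "nat \<Rightarrow> nat \<Rightarrow> nat \<Rightarrow> 'a set \<Rightarrow> (nat \<Rightarrow> 'a arr) \<Rightarrow> bool" where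
  "homogeneous_latin_trade \<mu> k m S T \<longleftrightarrow>
     \<mu> \<le> k \<and> k \<le> m \<and> card S = m \<and>
     mu_way_latin_trade \<mu> m S T \<and>
     (\<forall>r<\<mu>.
        (\<forall>i<m. card {j. (i, j) \<in> filled_cells (T r)} = k) \<and>
        (\<forall>j<m. card {i. (i, j) \<in> filled_cells (T r)} = k) \<and>
        (\<forall>s\<in>S. card {(i, j). T r i j = Some s} = k))"

end

theory Submission
  imports Defs
begin

text \<open>The trades are placed in the two diagonal blocks of a square of order \<open>m + n\<close> and their
  symbols are relabelled so that no symbol occurs in both blocks. Every row, column and symbol of
  the large square then meets exactly one of the blocks, so each condition defining a homogeneous
  trade, being a condition on single rows, columns, symbols or cells, is inherited from that block.
  The lemmas below compute the rows, columns, cells and symbol classes of the block sum in terms of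
  those of its summands. Since the symbols must again be natural numbers, the relabelling sends the
  two symbol sets to the even and to the odd numbers.\<close>

section \<open>Consequences of the definitions\<close>

lemma partial_latin_squareD:
  assumes "partial_latin_square m S A"
  shows "A i j = Some s \<Longrightarrow> A i j' = Some s \<Longrightarrow> j = j'"
    and "A i j = Some s \<Longrightarrow> A i' j = Some s \<Longrightarrow> i = i'"
    and "filled_cells A \<subseteq> {..<m} \<times> {..<m}"
    and "A i j = Some s \<Longrightarrow> s \<in> S"
  using assms unfolding partial_latin_square_def by blast+

lemma partial_latin_square_outside:
  assumes "partial_latin_square m S A" and "m \<le> i \<or> m \<le> j"
  shows "A i j = None"
proof (rule ccontr)
  assume "A i j \<noteq> None"
  then have "(i, j) \<in> filled_cells A"
    by (simp add: filled_cells_def)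
  with partial_latin_squareD(3)[OF assms(1)] assms(2) show False
    by auto
qed

lemma mu_way_latin_tradeD:
  assumes "mu_way_latin_trade \<mu> n S T" and r: "r < \<mu>" "r' < \<mu>"
  shows "filled_cells (T r) = filled_cells (T r')"
    and "r \<noteq> r' \<Longrightarrow> T r i j = Some a \<Longrightarrow> T r' i j \<noteq> Some a"
    and "i < n \<Longrightarrow> row_symbols (T r) i = row_symbols (T r') i"
    and "j < n \<Longrightarrow> col_symbols (T r) j = col_symbols (T r') j"
proof -
  note * = assms(1)[unfolded mu_way_latin_trade_def]
  from * have "\<forall>r<\<mu>. \<forall>r'<\<mu>. filled_cells (T r) = filled_cells (T r')"
    by (elim conjE)
  with r show "filled_cells (T r) = filled_cells (T r')"
    by blast
  from * have "\<forall>r<\<mu>. \<forall>r'<\<mu>. r \<noteq> r' \<longrightarrow>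
      (\<forall>(i, j) \<in> filled_cells (T r). T r i j \<noteq> T r' i j)"
    by (elim conjE)
  with r have "r \<noteq> r' \<Longrightarrow> \<forall>(i, j) \<in> filled_cells (T r). T r i j \<noteq> T r' i j"
    by blast
  then show "r \<noteq> r' \<Longrightarrow> T r i j = Some a \<Longrightarrow> T r' i j \<noteq> Some a"
    by (fastforce simp: filled_cells_def)
  from * have "\<forall>r<\<mu>. \<forall>r'<\<mu>. \<forall>i<n. row_symbols (T r) i = row_symbols (T r') i"
    by (elim conjE)
  with r show "i < n \<Longrightarrow> row_symbols (T r) i = row_symbols (T r') i"
    by blast
  from * have "\<forall>r<\<mu>. \<forall>r'<\<mu>. \<forall>j<n. col_symbols (T r) j = col_symbols (T r') j"
    by (elim conjE)
  with r show "j < n \<Longrightarrow> col_symbols (T r) j = col_symbols (T r') j"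
    by blast
qed

lemma homogeneous_latin_tradeD:
  assumes "homogeneous_latin_trade \<mu> k m S T" and r: "r < \<mu>"
  shows "i < m \<Longrightarrow> card {j. (i, j) \<in> filled_cells (T r)} = k"
    and "j < m \<Longrightarrow> card {i. (i, j) \<in> filled_cells (T r)} = k"
    and "s \<in> S \<Longrightarrow> card {(i, j). T r i j = Some s} = k"
proof -
  have "\<forall>r<\<mu>. (\<forall>i<m. card {j. (i, j) \<in> filled_cells (T r)} = k) \<and>
      (\<forall>j<m. card {i. (i, j) \<in> filled_cells (T r)} = k) \<and>
      (\<forall>s\<in>S. card {(i, j). T r i j = Some s} = k)"
    using assms(1)[unfolded homogeneous_latin_trade_def] by (elim conjE)
  note * = this[rule_format, OF r]
  show "i < m \<Longrightarrow> card {j. (i, j) \<in> filled_cells (T r)} = k"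
    using * by simp
  show "j < m \<Longrightarrow> card {i. (i, j) \<in> filled_cells (T r)} = k"
    using * by simp
  show "s \<in> S \<Longrightarrow> card {(i, j). T r i j = Some s} = k"
    using * by simp
qed

section \<open>Block sums of arrays\<close>

text \<open>Above and to the left of the second block the value is read off from \<open>A\<close>. As \<open>A\<close> is empty
  outside its own \<open>m \<times> m\<close> square, this leaves the two off-diagonal blocks empty.\<close>

definition block_sum :: "('a \<Rightarrow> 'c) \<Rightarrow> ('b \<Rightarrow> 'c) \<Rightarrow> nat \<Rightarrow> 'a arr \<Rightarrow> 'b arr \<Rightarrow> 'c arr" where
  "block_sum f g m A B i j =
     (if i < m \<or> j < m then map_option f (A i j) else map_option g (B (i - m) (j - m)))"

lemma block_sum_upper [simp]: "i < m \<Longrightarrow> block_sum f g m A B i j = map_option f (A i j)"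
  and block_sum_left [simp]: "j < m \<Longrightarrow> block_sum f g m A B i j = map_option f (A i j)"
  and block_sum_shifted [simp]: "block_sum f g m A B (m + i) (m + j) = map_option g (B i j)"
  by (simp_all add: block_sum_def)

text \<open>Each filled cell of a block sum comes from a unique summand. Applied to two cells in one row
  or column, this case split leaves only pure cases, which are statements about one summand: in a
  mixed case the common index would be both smaller than \<open>m\<close> and at least \<open>m\<close>.\<close>

lemma block_sum_cases:
  assumes "partial_latin_square m S A" and "block_sum f g m A B i j = Some s"
  obtains (first) a where "i < m" "j < m" "A i j = Some a" "s = f a"
  | (second) i' j' b where "i = m + i'" "j = m + j'" "B i' j' = Some b" "s = g b"
proof (cases "i < m \<or> j < m")
  case True
  then obtain a where "A i j = Some a" "s = f a"
    using assms(2) by (auto simp: block_sum_def)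
  moreover from this have "i < m" "j < m"
    using partial_latin_square_outside[OF assms(1), of i j] by (auto simp: not_less[symmetric])
  ultimately show thesis by (rule first[rotated 2])
next
  case False
  then obtain b where "B (i - m) (j - m) = Some b" "s = g b"
    using assms(2) by (auto simp: block_sum_def)
  with False show thesis by (intro second[of "i - m" "j - m" b]) auto
qed

lemma filled_cells_block_sum:
  assumes "partial_latin_square m S A"
  shows "filled_cells (block_sum f g m A B) =
    filled_cells A \<union> (\<lambda>(i, j). (m + i, m + j)) ` filled_cells B"
    (is "?L = ?R")
proof
  show "?L \<subseteq> ?R"
    unfolding filled_cells_def by (auto elim!: block_sum_cases[OF assms] simp: image_iff)
  show "?R \<subseteq> ?L"
    using partial_latin_square_outside[OF assms] unfolding filled_cells_def
    by (force simp: block_sum_def)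
qed

lemma row_symbols_block_sum_upper:
  assumes "i < m"
  shows "row_symbols (block_sum f g m A B) i = f ` row_symbols A i"
  using assms unfolding row_symbols_def by auto

lemma row_symbols_block_sum_lower:
  assumes "partial_latin_square m S A"
  shows "row_symbols (block_sum f g m A B) (m + i) = g ` row_symbols B i"
proof (intro set_eqI iffI)
  fix s assume "s \<in> row_symbols (block_sum f g m A B) (m + i)"
  then show "s \<in> g ` row_symbols B i"
    unfolding row_symbols_def by (auto elim!: block_sum_cases[OF assms] intro!: imageI)
next
  fix s assume "s \<in> g ` row_symbols B i"
  then obtain j b where "B i j = Some b" "s = g b"
    unfolding row_symbols_def by blast
  then have "block_sum f g m A B (m + i) (m + j) = Some s"
    by simp
  then show "s \<in> row_symbols (block_sum f g m A B) (m + i)"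
    unfolding row_symbols_def by blast
qed

lemma col_symbols_block_sum_left:
  assumes "j < m"
  shows "col_symbols (block_sum f g m A B) j = f ` col_symbols A j"
  using assms unfolding col_symbols_def by auto

lemma col_symbols_block_sum_right:
  assumes "partial_latin_square m S A"
  shows "col_symbols (block_sum f g m A B) (m + j) = g ` col_symbols B j"
proof (intro set_eqI iffI)
  fix s assume "s \<in> col_symbols (block_sum f g m A B) (m + j)"
  then show "s \<in> g ` col_symbols B j"
    unfolding col_symbols_def by (auto elim!: block_sum_cases[OF assms] intro!: imageI)
next
  fix s assume "s \<in> g ` col_symbols B j"
  then obtain i b where "B i j = Some b" "s = g b"
    unfolding col_symbols_def by blast
  then have "block_sum f g m A B (m + i) (m + j) = Some s"
    by simp
  then show "s \<in> col_symbols (block_sum f g m A B) (m + j)"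
    unfolding col_symbols_def by blast
qed

text \<open>This is what the relabelling is for. Rows and columns never see both summands, but a symbol
  common to the two would gather its occurrences from both blocks and so be counted twice over.\<close>

lemma disjoint_rangesD:
  assumes "range f \<inter> range g = {}"
  shows "f a \<noteq> g b" and "g b \<noteq> f a"
  using assms by (metis disjoint_iff rangeI)+

lemma symbol_cells_block_sum_first:
  assumes "partial_latin_square m S A" and "inj f" and "range f \<inter> range g = {}"
  shows "{(i, j). block_sum f g m A B i j = Some (f a)} = {(i, j). A i j = Some a}"
proof -
  have "block_sum f g m A B i j = Some (f a) \<longleftrightarrow> A i j = Some a" for i j
  proof
    assume "block_sum f g m A B i j = Some (f a)"
    then show "A i j = Some a"
      using disjoint_rangesD[OF assms(3)]
      by (elim block_sum_cases[OF assms(1)]) (auto simp: inj_eq[OF assms(2)])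
  next
    assume "A i j = Some a"
    moreover from this have "i < m"
      using partial_latin_square_outside[OF assms(1), of i j] by (cases "i < m") auto
    ultimately show "block_sum f g m A B i j = Some (f a)" by simp
  qed
  then show ?thesis by simp
qed

lemma symbol_cells_block_sum_second:
  assumes "partial_latin_square m S A" and "inj g" and "range f \<inter> range g = {}"
  shows "{(i, j). block_sum f g m A B i j = Some (g b)} =
    (\<lambda>(i, j). (m + i, m + j)) ` {(i, j). B i j = Some b}"
  using disjoint_rangesD[OF assms(3)]
  by (auto elim!: block_sum_cases[OF assms(1)] simp: inj_eq[OF assms(2)] image_iff)

section \<open>Block sums of trades\<close>

lemma partial_latin_square_block_sum:
  assumes A: "partial_latin_square m S A" and B: "partial_latin_square n R B"
    and inj: "inj f" "inj g"
  shows "partial_latin_square (m + n) (f ` S \<union> g ` R) (block_sum f g m A B)"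
    (is "partial_latin_square _ _ ?C")
  unfolding partial_latin_square_def
proof (intro conjI allI impI)
  note cases = block_sum_cases[OF A]
  show "finite (f ` S \<union> g ` R)"
    using A B by (auto simp: partial_latin_square_def)
  show "filled_cells ?C \<subseteq> {..<m + n} \<times> {..<m + n}"
    using partial_latin_squareD(3)[OF A] partial_latin_squareD(3)[OF B]
    unfolding filled_cells_block_sum[OF A] by force
  show "s \<in> f ` S \<union> g ` R" if "?C i j = Some s" for i j s
    using that by (elim cases)
      (auto intro: partial_latin_squareD(4)[OF A] partial_latin_squareD(4)[OF B])
  show "j = j'" if "?C i j = Some s \<and> ?C i j' = Some s" for i j j' s
  proof -
    from that have "?C i j = Some s" "?C i j' = Some s" by auto
    then show ?thesis
      by (elim cases)
        (simp_all add: inj_eq[OF inj(1)] inj_eq[OF inj(2)],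
         (blast intro: partial_latin_squareD(1)[OF A] partial_latin_squareD(1)[OF B])+)
  qed
  show "i = i'" if "?C i j = Some s \<and> ?C i' j = Some s" for i i' j s
  proof -
    from that have "?C i j = Some s" "?C i' j = Some s" by auto
    then show ?thesis
      by (elim cases)
        (simp_all add: inj_eq[OF inj(1)] inj_eq[OF inj(2)],
         (blast intro: partial_latin_squareD(2)[OF A] partial_latin_squareD(2)[OF B])+)
  qed
qed

text \<open>The form in which the conditions on all rows and columns split into conditions on the two
  blocks.\<close>

lemma all_less_add_iff: "(\<forall>i<m + n. P i) \<longleftrightarrow> (\<forall>i<m. P i) \<and> (\<forall>i<n. P (m + i))" for m n :: nat
proof (intro iffI conjI allI impI)
  fix i assume *: "(\<forall>i<m. P i) \<and> (\<forall>i<n. P (m + i))" and "i < m + n"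
  then show "P i"
    by (cases "i < m") (auto dest: spec[of _ "i - m"])
qed auto

lemma mu_way_latin_trade_block_sum:
  assumes T: "mu_way_latin_trade \<mu> m S T" and U: "mu_way_latin_trade \<mu> n R U"
    and inj: "inj f" "inj g"
  shows "mu_way_latin_trade \<mu> (m + n) (f ` S \<union> g ` R) (\<lambda>r. block_sum f g m (T r) (U r))"
proof -
  have pT: "partial_latin_square m S (T r)" if "r < \<mu>" for r
    using T that by (simp add: mu_way_latin_trade_def)
  have pU: "partial_latin_square n R (U r)" if "r < \<mu>" for r
    using U that by (simp add: mu_way_latin_trade_def)
  show ?thesis
    unfolding mu_way_latin_trade_def all_less_add_iff[of m n]
  proof (intro conjI allI impI)
    show "1 \<le> \<mu>"
      using T by (simp add: mu_way_latin_trade_def)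
  next
    fix r assume "r < \<mu>"
    then show "partial_latin_square (m + n) (f ` S \<union> g ` R) (block_sum f g m (T r) (U r))"
      by (intro partial_latin_square_block_sum pT pU inj)
  next
    fix r r' assume r: "r < \<mu>" "r' < \<mu>"
    then show "filled_cells (block_sum f g m (T r) (U r)) =
        filled_cells (block_sum f g m (T r') (U r'))"
      unfolding filled_cells_block_sum[OF pT[OF r(1)]] filled_cells_block_sum[OF pT[OF r(2)]]
      by (simp only: mu_way_latin_tradeD(1)[OF T r] mu_way_latin_tradeD(1)[OF U r])
  next
    fix r r' assume r: "r < \<mu>" "r' < \<mu>" "r \<noteq> r'"
    have "block_sum f g m (T r') (U r') i j \<noteq> Some s"
      if "block_sum f g m (T r) (U r) i j = Some s" for i j s
      using that
    proof (rule block_sum_cases[OF pT[OF r(1)]])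
      fix a assume "i < m" "T r i j = Some a" "s = f a"
      with mu_way_latin_tradeD(2)[OF T r] show ?thesis
        by (auto simp: inj_eq[OF inj(1)])
    next
      fix i' j' b assume "i = m + i'" "j = m + j'" "U r i' j' = Some b" "s = g b"
      with mu_way_latin_tradeD(2)[OF U r] show ?thesis
        by (auto simp: inj_eq[OF inj(2)])
    qed
    then show "\<forall>(i, j) \<in> filled_cells (block_sum f g m (T r) (U r)).
        block_sum f g m (T r) (U r) i j \<noteq> block_sum f g m (T r') (U r') i j"
      by (fastforce simp: filled_cells_def)
  next
    fix r r' i assume "r < \<mu>" "r' < \<mu>" "i < m"
    then show "row_symbols (block_sum f g m (T r) (U r)) i =
        row_symbols (block_sum f g m (T r') (U r')) i"
      by (simp add: row_symbols_block_sum_upper mu_way_latin_tradeD(3)[OF T, of r r'])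
  next
    fix r r' i assume "r < \<mu>" "r' < \<mu>" "i < n"
    then show "row_symbols (block_sum f g m (T r) (U r)) (m + i) =
        row_symbols (block_sum f g m (T r') (U r')) (m + i)"
      by (simp add: row_symbols_block_sum_lower[OF pT] mu_way_latin_tradeD(3)[OF U, of r r'])
  next
    fix r r' j assume "r < \<mu>" "r' < \<mu>" "j < m"
    then show "col_symbols (block_sum f g m (T r) (U r)) j =
        col_symbols (block_sum f g m (T r') (U r')) j"
      by (simp add: col_symbols_block_sum_left mu_way_latin_tradeD(4)[OF T, of r r'])
  next
    fix r r' j assume "r < \<mu>" "r' < \<mu>" "j < n"
    then show "col_symbols (block_sum f g m (T r) (U r)) (m + j) =
        col_symbols (block_sum f g m (T r') (U r')) (m + j)"
      by (simp add: col_symbols_block_sum_right[OF pT] mu_way_latin_tradeD(4)[OF U, of r r'])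
  qed
qed

text \<open>Each line of the sum, and each symbol, has as many cells as in the one summand it comes
  from. It is therefore essential that both summands have the same \<open>k\<close>, whereas their orders
  are independent.\<close>

lemma homogeneous_latin_trade_block_sum:
  assumes T: "homogeneous_latin_trade \<mu> k m S T" and U: "homogeneous_latin_trade \<mu> k n R U"
    and inj: "inj f" "inj g" and disj: "range f \<inter> range g = {}"
  shows "homogeneous_latin_trade \<mu> k (m + n) (f ` S \<union> g ` R) (\<lambda>r. block_sum f g m (T r) (U r))"
proof -
  have tT: "mu_way_latin_trade \<mu> m S T" and tU: "mu_way_latin_trade \<mu> n R U"
    using T U by (simp_all add: homogeneous_latin_trade_def)
  have pT: "partial_latin_square m S (T r)" if "r < \<mu>" for r
    using tT that by (simp add: mu_way_latin_trade_def)
  have pU: "partial_latin_square n R (U r)" if "r < \<mu>" for r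
    using tU that by (simp add: mu_way_latin_trade_def)
  \<comment> \<open>Finiteness of the symbol sets is a property of the squares of the trade, so it needs
    the trade to have at least one square.\<close>
  have "0 < \<mu>"
    using tT by (simp add: mu_way_latin_trade_def)
  then have fin: "finite S" "finite R"
    using pT pU unfolding partial_latin_square_def by blast+
  have inj_shift: "inj_on (\<lambda>(i, j). (m + i, m + j)) X" for X :: "(nat \<times> nat) set"
    by (auto intro!: inj_onI)
  show ?thesis
    unfolding homogeneous_latin_trade_def all_less_add_iff[of m n]
  proof (intro conjI allI impI ballI)
    show "\<mu> \<le> k" "k \<le> m + n"
      using T unfolding homogeneous_latin_trade_def by linarith+
    have "card (f ` S \<union> g ` R) = card S + card R"
      using fin disj
      by (subst card_Un_disjoint)
        (auto simp: card_image inj_on_subset[OF inj(1)] inj_on_subset[OF inj(2)])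
    then show "card (f ` S \<union> g ` R) = m + n"
      using T U by (simp add: homogeneous_latin_trade_def)
    show "mu_way_latin_trade \<mu> (m + n) (f ` S \<union> g ` R) (\<lambda>r. block_sum f g m (T r) (U r))"
      by (rule mu_way_latin_trade_block_sum[OF tT tU inj])
  next
    fix r i assume "r < \<mu>" "i < m"
    then have "{j. (i, j) \<in> filled_cells (block_sum f g m (T r) (U r))} =
        {j. (i, j) \<in> filled_cells (T r)}"
      by (simp add: filled_cells_def)
    then show "card {j. (i, j) \<in> filled_cells (block_sum f g m (T r) (U r))} = k"
      using homogeneous_latin_tradeD(1)[OF T \<open>r < \<mu>\<close> \<open>i < m\<close>] by simp
  next
    fix r j assume "r < \<mu>" "j < m"
    then have "{i. (i, j) \<in> filled_cells (block_sum f g m (T r) (U r))} =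
        {i. (i, j) \<in> filled_cells (T r)}"
      by (simp add: filled_cells_def)
    then show "card {i. (i, j) \<in> filled_cells (block_sum f g m (T r) (U r))} = k"
      using homogeneous_latin_tradeD(2)[OF T \<open>r < \<mu>\<close> \<open>j < m\<close>] by simp
  next
    fix r i assume r: "r < \<mu>" and i: "i < n"
    have "{j. (m + i, j) \<in> filled_cells (block_sum f g m (T r) (U r))} =
        (+) m ` {j. (i, j) \<in> filled_cells (U r)}"
      using partial_latin_squareD(3)[OF pT[OF r]]
      by (auto simp: filled_cells_block_sum[OF pT[OF r]] dest: subsetD)
    then show "card {j. (m + i, j) \<in> filled_cells (block_sum f g m (T r) (U r))} = k"
      using homogeneous_latin_tradeD(1)[OF U r i] by (simp add: card_image)
  next
    fix r j assume r: "r < \<mu>" and j: "j < n"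
    have "{i. (i, m + j) \<in> filled_cells (block_sum f g m (T r) (U r))} =
        (+) m ` {i. (i, j) \<in> filled_cells (U r)}"
      using partial_latin_squareD(3)[OF pT[OF r]]
      by (auto simp: filled_cells_block_sum[OF pT[OF r]] dest: subsetD)
    then show "card {i. (i, m + j) \<in> filled_cells (block_sum f g m (T r) (U r))} = k"
      using homogeneous_latin_tradeD(2)[OF U r j] by (simp add: card_image)
  next
    fix r s assume r: "r < \<mu>" and "s \<in> f ` S \<union> g ` R"
    then consider a where "a \<in> S" "s = f a" | b where "b \<in> R" "s = g b"
      by blast
    then show "card {(i, j). block_sum f g m (T r) (U r) i j = Some s} = k"
    proof cases
      case 1
      then show ?thesis
        using homogeneous_latin_tradeD(3)[OF T r]
        by (simp add: symbol_cells_block_sum_first[OF pT[OF r] inj(1) disj])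
    next
      case 2
      then show ?thesis
        using homogeneous_latin_tradeD(3)[OF U r]
        by (simp add: symbol_cells_block_sum_second[OF pT[OF r] inj(2) disj]
            card_image[OF inj_shift])
    qed
  qed
qed

theorem theorem7:
  fixes \<mu> k m n :: nat
  assumes "1 \<le> \<mu>" and "1 \<le> k" and "1 \<le> m" and "1 \<le> n"
    and "\<exists>(S :: nat set) T. homogeneous_latin_trade \<mu> k m S T"
    and "\<exists>(S :: nat set) T. homogeneous_latin_trade \<mu> k n S T"
  shows "\<exists>(S :: nat set) T. homogeneous_latin_trade \<mu> k (m + n) S T"
proof -
  from assms(5,6) obtain S R :: "nat set" and T U
    where TU: "homogeneous_latin_trade \<mu> k m S T" "homogeneous_latin_trade \<mu> k n R U"
    by blast
  define f g :: "nat \<Rightarrow> nat" where "f = (\<lambda>s. 2 * s)" and "g = (\<lambda>s. 2 * s + 1)"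
  have "inj f" "inj g"
    by (auto simp: f_def g_def inj_def)
  moreover have "range f \<inter> range g = {}"
    by (auto simp: f_def g_def) presburger
  ultimately show ?thesis
    using homogeneous_latin_trade_block_sum[OF TU] by blast
qed

end
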